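(* Let $d\in\mathbb{N}$. Then for any integer $k\geq 19^{2d-1}+1$ and any homeomorphism $F\colon S_{\ell_\infty^k}\to S_{\ell_1^k}$ that does not increase support size, we have $\omega_F(\tfrac1d)\geq \tfrac12$. In particular, there is no sequence $(F_k\colon S_{\ell_\infty^k}\to S_{\ell_1^k})_{k=1}^\infty$ of equi-uniformly continuous homeomorphisms that do not increase support size.
   Context: For $p\in\{1,\infty\}$, $S_{\ell_p^k}$ denotes the unit sphere of $\mathbb{R}^k$ with the $\ell_p$-norm. For $x=(x_i)_{i=1}^k\in\mathbb{R}^k$, $\mathrm{supp}(x)=\{i\in\{1,\dots,k\}: x_i\neq0\}$. A map $F\colon S_{\ell_\infty^k}\to S_{\ell_1^k}$ does not increase support size if $|\mathrm{supp}(F(x))|\leq|\mathrm{supp}(x)|$ for all $x\in S_{\ell_\infty^k}$. For a map $F\colon(X,d_X)\to(Y,d_Y)$ between metric spaces, its modulus of uniform continuity is $\omega_F(t)=\sup\{d_Y(F(x),F(y)): d_X(x,y)\leq t\}$ for $t\ge 0$. A sequence of maps $(F_k)_k$ between metric spaces is equi-uniformly continuous if for every $\varepsilon>0$ there is $\delta>0$ with $\omega_{F_k}(\delta)<\varepsilon$ for all $k$. *)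

theory Defs
  imports Complex_Main
begin

text \<open>Vectors of R^k are represented as functions nat => real vanishing at all
  indices >= k (coordinates are indexed by 0..k-1).\<close>

definition vecs :: "nat \<Rightarrow> (nat \<Rightarrow> real) set" where
  "vecs k = {x. \<forall>i\<ge>k. x i = 0}"

definition norm_inf :: "nat \<Rightarrow> (nat \<Rightarrow> real) \<Rightarrow> real" where
  "norm_inf k x = Max (insert 0 ((\<lambda>i. \<bar>x i\<bar>) ` {..<k}))"

definition norm_one :: "nat \<Rightarrow> (nat \<Rightarrow> real) \<Rightarrow> real" where
  "norm_one k x = (\<Sum>i<k. \<bar>x i\<bar>)"

definition dist_inf :: "nat \<Rightarrow> (nat \<Rightarrow> real) \<Rightarrow> (nat \<Rightarrow> real) \<Rightarrow> real" where
  "dist_inf k x y = norm_inf k (\<lambda>i. x i - y i)"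

definition dist_one :: "nat \<Rightarrow> (nat \<Rightarrow> real) \<Rightarrow> (nat \<Rightarrow> real) \<Rightarrow> real" where
  "dist_one k x y = norm_one k (\<lambda>i. x i - y i)"

definition sphere_inf :: "nat \<Rightarrow> (nat \<Rightarrow> real) set" where
  "sphere_inf k = {x \<in> vecs k. norm_inf k x = 1}"

definition sphere_one :: "nat \<Rightarrow> (nat \<Rightarrow> real) set" where
  "sphere_one k = {x \<in> vecs k. norm_one k x = 1}"

definition supp :: "nat \<Rightarrow> (nat \<Rightarrow> real) \<Rightarrow> nat set" where
  "supp k x = {i. i < k \<and> x i \<noteq> 0}"

definition metric_cont_on ::
  "'a set \<Rightarrow> ('a \<Rightarrow> 'a \<Rightarrow> real) \<Rightarrow> ('b \<Rightarrow> 'b \<Rightarrow> real) \<Rightarrow> ('a \<Rightarrow> 'b) \<Rightarrow> bool" where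
  "metric_cont_on A dA dB f \<longleftrightarrow>
     (\<forall>x\<in>A. \<forall>e>0. \<exists>\<delta>>0. \<forall>y\<in>A. dA x y < \<delta> \<longrightarrow> dB (f x) (f y) < e)"

definition homeo_spheres :: "nat \<Rightarrow> ((nat \<Rightarrow> real) \<Rightarrow> (nat \<Rightarrow> real)) \<Rightarrow> bool" where
  "homeo_spheres k F \<longleftrightarrow>
     bij_betw F (sphere_inf k) (sphere_one k) \<and>
     metric_cont_on (sphere_inf k) (dist_inf k) (dist_one k) F \<and>
     metric_cont_on (sphere_one k) (dist_one k) (dist_inf k) (inv_into (sphere_inf k) F)"

definition no_supp_increase :: "nat \<Rightarrow> ((nat \<Rightarrow> real) \<Rightarrow> (nat \<Rightarrow> real)) \<Rightarrow> bool" where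
  "no_supp_increase k F \<longleftrightarrow> (\<forall>x\<in>sphere_inf k. card (supp k (F x)) \<le> card (supp k x))"

definition modulus :: "nat \<Rightarrow> ((nat \<Rightarrow> real) \<Rightarrow> (nat \<Rightarrow> real)) \<Rightarrow> real \<Rightarrow> real" where
  "modulus k F t = Sup {dist_one k (F x) (F y) | x y.
      x \<in> sphere_inf k \<and> y \<in> sphere_inf k \<and> dist_inf k x y \<le> t}"

end

theory Submission
  imports Defs "HOL-Analysis.Elementary_Metric_Spaces" "HOL-Combinatorics.Permutations" "HOL-Library.Discrete_Functions"
begin

text \<open>
  The inverse of \<open>F\<close> maps points of full support to points of full support, so it maps each
  open orthant cell into one open orthant cell; by surjectivity and finiteness it permutes the
  closed cells. Hence two adjacent maximal cells are mapped to adjacent ones, and after an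
  injective relabelling \<open>\<pi>\<close> of the coordinates, \<open>x i = 0\<close> implies \<open>F x (\<pi> i) = 0\<close> for \<open>x \<ge> 0\<close>.

  The vectors \<open>x\<close> used have coordinates in \<open>{0, 1/d, ..., 1}\<close>, each value being taken about
  twice as often as the next larger one. Coordinates of adjacent values are matched in pairs
  and \<open>y\<close> arises from \<open>x\<close> by exchanging all pairs, so \<open>x\<close> and \<open>y\<close> are at distance \<open>1/d\<close>. Average
  the mass that \<open>\<bar>F x\<bar>\<close> puts on a coordinate over all permutations of \<open>x\<close>: the result depends
  only on the value of the coordinate and vanishes at the value \<open>0\<close>. So the upper members of
  the pairs carry at least twice the mass of the lower ones, that is, at least \<open>2/3\<close> of it, while
  after the exchange the same coordinates carry at most \<open>1/3\<close>. Some permutation therefore moves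
  \<open>F\<close> by at least \<open>2/3\<close>.
\<close>

section \<open>Coordinatewise bounds for the two norms\<close>

lemma norm_inf_le_iff: "norm_inf k x \<le> c \<longleftrightarrow> 0 \<le> c \<and> (\<forall>i<k. \<bar>x i\<bar> \<le> c)"
  by (auto simp: norm_inf_def)

lemma norm_inf_eq_1_iff: "norm_inf k x = 1 \<longleftrightarrow> (\<forall>i<k. \<bar>x i\<bar> \<le> 1) \<and> (\<exists>i<k. \<bar>x i\<bar> = 1)"
proof
  assume 1: "norm_inf k x = 1"
  have "norm_inf k x \<in> insert 0 ((\<lambda>i. \<bar>x i\<bar>) ` {..<k})"
    unfolding norm_inf_def by (rule Max_in) auto
  with 1 have "\<exists>i<k. \<bar>x i\<bar> = 1" by auto
  with 1 norm_inf_le_iff[of k x 1] show "(\<forall>i<k. \<bar>x i\<bar> \<le> 1) \<and> (\<exists>i<k. \<bar>x i\<bar> = 1)"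
    by auto
next
  assume *: "(\<forall>i<k. \<bar>x i\<bar> \<le> 1) \<and> (\<exists>i<k. \<bar>x i\<bar> = 1)"
  then have "norm_inf k x \<le> 1" "1 \<le> norm_inf k x"
    using norm_inf_le_iff[of k x 1] norm_inf_le_iff[of k x "norm_inf k x"] by auto
  then show "norm_inf k x = 1" by simp
qed

lemma abs_le_norm_inf: "i < k \<Longrightarrow> \<bar>x i\<bar> \<le> norm_inf k x"
  using norm_inf_le_iff by blast

lemma abs_le_norm_one: "i < k \<Longrightarrow> \<bar>x i\<bar> \<le> norm_one k x"
  unfolding norm_one_def by (rule member_le_sum) auto

section \<open>Continuity of coordinates along paths\<close>

text \<open>Turns \<open>metric_cont_on\<close> into \<open>continuous_on\<close> for a real
  function of one real variable, so that the intermediate value theorem and limit arguments apply to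
  single coordinates.\<close>

lemma continuous_on_metric_cont_path:
  fixes \<gamma> :: "real \<Rightarrow> 'a" and f :: "'a \<Rightarrow> nat \<Rightarrow> real"
  assumes f: "metric_cont_on A dA dB f"
    and \<gamma>: "\<And>t. t \<in> I \<Longrightarrow> \<gamma> t \<in> A"
    and lip: "\<And>s t. dA (\<gamma> s) (\<gamma> t) \<le> C * \<bar>s - t\<bar>"
    and coord: "\<And>u v. \<bar>u i - v i\<bar> \<le> dB u v"
  shows "continuous_on I (\<lambda>t. f (\<gamma> t) i)"
  unfolding continuous_on_iff
proof (intro ballI allI impI)
  fix t and e :: real assume t: "t \<in> I" and "0 < e"
  then obtain \<delta> where \<delta>: "\<delta> > 0" "\<And>y. y \<in> A \<Longrightarrow> dA (\<gamma> t) y < \<delta> \<Longrightarrow> dB (f (\<gamma> t)) (f y) < e"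
    using f \<gamma> unfolding metric_cont_on_def by metis
  \<comment> \<open>The \<open>+ 1\<close> keeps the denominator positive, whatever \<open>C\<close>
    is.\<close>
  have "\<bar>f (\<gamma> s) i - f (\<gamma> t) i\<bar> < e" if "s \<in> I" "\<bar>s - t\<bar> < \<delta> / (\<bar>C\<bar> + 1)" for s
  proof -
    have "dA (\<gamma> t) (\<gamma> s) \<le> C * \<bar>t - s\<bar>" by (rule lip)
    also have "\<dots> \<le> (\<bar>C\<bar> + 1) * \<bar>s - t\<bar>"
      by (subst abs_minus_commute, rule mult_right_mono) auto
    also have "\<dots> < \<delta>" using that(2) by (simp add: field_simps)
    finally have "dB (f (\<gamma> t)) (f (\<gamma> s)) < e" using \<delta>(2) \<gamma> that(1) by blast
    with coord[where u="f (\<gamma> t)" and v="f (\<gamma> s)"] show ?thesis by (simp add: abs_minus_commute)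
  qed
  moreover have "\<delta> / (\<bar>C\<bar> + 1) > 0" using \<delta>(1) by simp
  ultimately show "\<exists>\<delta>>0. \<forall>s\<in>I. dist s t < \<delta> \<longrightarrow> dist (f (\<gamma> s) i) (f (\<gamma> t) i) < e"
    unfolding dist_real_def by blast
qed

lemma continuous_on_nonzero_same_sign:
  fixes f :: "real \<Rightarrow> real"
  assumes "continuous_on {0..1} f" "\<And>t. t \<in> {0..1} \<Longrightarrow> f t \<noteq> 0"
  shows "0 < f 0 * f 1"
proof (rule ccontr)
  assume "\<not> 0 < f 0 * f 1"
  then have "f 0 \<le> 0 \<and> 0 \<le> f 1 \<or> f 1 \<le> 0 \<and> 0 \<le> f 0"
    by (auto simp: zero_less_mult_iff not_less)
  then show False
    using IVT'[of f 0 0 1] IVT2'[of f 1 0 0] assms by fastforce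
qed

lemma continuous_on_nonneg_at_0:
  fixes f :: "real \<Rightarrow> real"
  assumes f: "continuous_on {0..1} f" and pos: "\<And>t. 0 < t \<Longrightarrow> t \<le> 1 \<Longrightarrow> 0 \<le> f t"
  shows "0 \<le> f 0"
proof (rule ccontr)
  assume "\<not> 0 \<le> f 0"
  then obtain \<delta> where "\<delta> > 0" "\<And>t. t \<in> {0..1} \<Longrightarrow> dist t 0 < \<delta> \<Longrightarrow> dist (f t) (f 0) < - f 0"
    using f unfolding continuous_on_iff by (metis atLeastAtMost_iff neg_0_less_iff_less not_le order_refl zero_le_one)
  \<comment> \<open>At this point of \<open>{0..1}\<close> the value is nonnegative, yet within
    \<open>- f 0\<close> of the negative number \<open>f 0\<close>.\<close>
  from this(1) this(2)[of "min 1 (\<delta>/2)"] pos[of "min 1 (\<delta>/2)"] show False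
    by (cases "2 \<le> \<delta>") (auto simp: dist_real_def min_def)
qed

section \<open>Closed and open orthants\<close>

text \<open>Orthants are indexed by their set of positive coordinates. Only the part of the index
  set below \<open>k\<close> matters, so uniqueness is stated for subsets of
  \<open>{..<k}\<close>.\<close>

definition sg :: "nat set \<Rightarrow> nat \<Rightarrow> real" where
  "sg S i = (if i \<in> S then 1 else -1)"

definition cell :: "nat \<Rightarrow> nat set \<Rightarrow> (nat \<Rightarrow> real) set" where
  "cell k S = {x. \<forall>i<k. 0 \<le> sg S i * x i}"

definition open_cell :: "nat \<Rightarrow> nat set \<Rightarrow> (nat \<Rightarrow> real) set" where
  "open_cell k S = {x. \<forall>i<k. 0 < sg S i * x i}"

lemma open_cell_cell_eq:
  assumes "x \<in> open_cell k S" "x \<in> cell k T" "S \<subseteq> {..<k}" "T \<subseteq> {..<k}"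
  shows "S = T"
proof (rule set_eqI)
  fix i show "i \<in> S \<longleftrightarrow> i \<in> T"
  proof (cases "i < k")
    case True
    with assms(1,2) have "0 < sg S i * x i" "0 \<le> sg T i * x i"
      by (auto simp: open_cell_def cell_def)
    then show ?thesis by (auto simp: sg_def split: if_splits)
  qed (use assms in auto)
qed

lemma ex_cell: "\<exists>S\<subseteq>{..<k}. x \<in> cell k S"
  by (rule exI[of _ "{i. i < k \<and> 0 \<le> x i}"]) (auto simp: cell_def sg_def)

section \<open>The action of the homeomorphism on orthants\<close>

locale supp_homeo =
  fixes k :: nat and F :: "(nat \<Rightarrow> real) \<Rightarrow> nat \<Rightarrow> real"
  assumes homeo: "homeo_spheres k F" and supp_le: "no_supp_increase k F" and k_pos: "0 < k"
begin

definition G where "G = inv_into (sphere_inf k) F"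

lemma F_in: "x \<in> sphere_inf k \<Longrightarrow> F x \<in> sphere_one k"
  using homeo by (auto simp: homeo_spheres_def bij_betw_def)

lemma G_in: "y \<in> sphere_one k \<Longrightarrow> G y \<in> sphere_inf k"
  using homeo unfolding G_def homeo_spheres_def bij_betw_def by (metis inv_into_into)

lemma F_G: "y \<in> sphere_one k \<Longrightarrow> F (G y) = y"
  using homeo unfolding G_def homeo_spheres_def bij_betw_def by (metis f_inv_into_f)

lemma G_F: "x \<in> sphere_inf k \<Longrightarrow> G (F x) = x"
  using homeo unfolding G_def homeo_spheres_def bij_betw_def by (metis inv_into_f_f)

lemma cont_F: "metric_cont_on (sphere_inf k) (dist_inf k) (dist_one k) F"
  and cont_G: "metric_cont_on (sphere_one k) (dist_one k) (dist_inf k) G"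
  using homeo by (auto simp: homeo_spheres_def G_def)

text \<open>Inside one closed orthant the \<open>norm_one\<close> norm is additive, so segments stay
  on the sphere; moving towards an interior point makes every coordinate nonzero at once.\<close>

lemma segment_cell:
  assumes y: "y \<in> sphere_one k" "y \<in> cell k S" and z: "z \<in> sphere_one k" "z \<in> open_cell k S"
    and t: "0 \<le> t" "t \<le> 1"
  shows "(\<lambda>i. (1 - t) * y i + t * z i) \<in> sphere_one k"
    and "0 < t \<or> y \<in> open_cell k S \<Longrightarrow> (\<lambda>i. (1 - t) * y i + t * z i) \<in> open_cell k S"
proof -
  have 1: "\<bar>(1 - t) * y i + t * z i\<bar> = (1 - t) * \<bar>y i\<bar> + t * \<bar>z i\<bar>" if "i < k" for i
  proof -
    have "0 \<le> sg S i * y i" "0 < sg S i * z i"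
      using that y(2) z(2) by (auto simp: cell_def open_cell_def)
    moreover have "\<bar>u\<bar> = sg S i * u" if "0 \<le> sg S i * u" for u
      using that by (auto simp: sg_def split: if_splits)
    moreover have "sg S i * ((1 - t) * y i + t * z i) = (1 - t) * (sg S i * y i) + t * (sg S i * z i)"
      by (simp add: algebra_simps)
    ultimately show ?thesis using t by auto
  qed
  have "(\<Sum>i<k. \<bar>(1 - t) * y i + t * z i\<bar>) = (1 - t) * (\<Sum>i<k. \<bar>y i\<bar>) + t * (\<Sum>i<k. \<bar>z i\<bar>)"
    by (simp add: 1 sum.distrib sum_distrib_left)
  with y(1) z(1) show "(\<lambda>i. (1 - t) * y i + t * z i) \<in> sphere_one k"
    by (auto simp: sphere_one_def vecs_def norm_one_def)
  show "(\<lambda>i. (1 - t) * y i + t * z i) \<in> open_cell k S" if *: "0 < t \<or> y \<in> open_cell k S"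
  proof -
    have "0 < sg S i * ((1 - t) * y i + t * z i)" if "i < k" for i
    proof -
      have a: "0 \<le> sg S i * y i" "0 < sg S i * z i" "0 < t \<or> 0 < sg S i * y i"
        using that y(2) z(2) * by (auto simp: cell_def open_cell_def)
      have "0 < (1 - t) * (sg S i * y i) + t * (sg S i * z i)"
      proof (cases "0 < t")
        case True
        then show ?thesis using a t by (intro add_nonneg_pos) auto
      qed (use a t in auto)
      then show ?thesis by (simp add: algebra_simps)
    qed
    then show ?thesis by (simp add: open_cell_def)
  qed
qed

lemma continuous_on_G_segment:
  assumes "\<And>t. t \<in> {0..1} \<Longrightarrow> (\<lambda>i. (1 - t) * y i + t * z i) \<in> sphere_one k" and "i < k"
  shows "continuous_on {0..1} (\<lambda>t. G (\<lambda>i. (1 - t) * y i + t * z i) i)"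
proof (rule continuous_on_metric_cont_path[OF cont_G assms(1), where C = "norm_one k (\<lambda>i. z i - y i)"])
  show "\<bar>u i - v i\<bar> \<le> dist_inf k u v" for u v
    unfolding dist_inf_def by (rule abs_le_norm_inf) fact
  show "dist_one k (\<lambda>i. (1 - s) * y i + s * z i) (\<lambda>i. (1 - t) * y i + t * z i)
      \<le> norm_one k (\<lambda>i. z i - y i) * \<bar>s - t\<bar>" for s t
  proof -
    have "\<bar>((1 - s) * y i + s * z i) - ((1 - t) * y i + t * z i)\<bar> = \<bar>z i - y i\<bar> * \<bar>s - t\<bar>" for i
      unfolding abs_mult[symmetric] by (rule arg_cong[where f=abs]) (simp add: algebra_simps)
    then show ?thesis by (simp add: dist_one_def norm_one_def sum_distrib_right)
  qed
qed auto

text \<open>This is where the support hypothesis enters: a point of full support can only come from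
  a point of full support.\<close>

lemma G_nonzero:
  assumes "y \<in> sphere_one k" "y \<in> open_cell k S" "i < k"
  shows "G y i \<noteq> 0"
proof -
  have "supp k y = {..<k}" using assms(2) by (auto simp: supp_def open_cell_def)
  moreover have "card (supp k y) \<le> card (supp k (G y))"
    using supp_le G_in[OF assms(1)] F_G[OF assms(1)] unfolding no_supp_increase_def by metis
  moreover have "supp k (G y) \<subseteq> {..<k}" by (auto simp: supp_def)
  ultimately have "supp k (G y) = {..<k}"
    by (metis card_seteq finite_lessThan)
  with assms(3) show ?thesis by (auto simp: supp_def)
qed

definition center :: "nat set \<Rightarrow> nat \<Rightarrow> real" where
  "center S i = (if i < k then sg S i / real k else 0)"

lemma center_in: "center S \<in> sphere_one k" "center S \<in> open_cell k S"
proof -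
  have "\<bar>center S i\<bar> = 1 / real k" if "i < k" for i
    using that by (simp add: center_def sg_def)
  then show "center S \<in> sphere_one k"
    using k_pos by (auto simp: sphere_one_def vecs_def norm_one_def center_def)
  show "center S \<in> open_cell k S"
    using k_pos by (auto simp: center_def open_cell_def sg_def)
qed

text \<open>The sign pattern of \<open>G\<close> on the open cell of \<open>S\<close>, read off at
  one representative; \<open>G_open_cell\<close> shows that the choice does not matter.\<close>

definition \<tau> :: "nat set \<Rightarrow> nat set" where
  "\<tau> S = {i. i < k \<and> 0 < G (center S) i}"

lemma open_cell_subset: "x \<in> open_cell k S \<Longrightarrow> x \<in> cell k S"
  by (auto simp: open_cell_def cell_def less_imp_le)

text \<open>On the segment to the center no coordinate of \<open>G\<close> vanishes, so none changes
  sign.\<close>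

lemma G_open_cell:
  assumes y: "y \<in> sphere_one k" "y \<in> open_cell k S"
  shows "G y \<in> open_cell k (\<tau> S)"
  unfolding open_cell_def
proof (intro CollectI allI impI)
  fix i assume i: "i < k"
  note seg = segment_cell[OF y(1) open_cell_subset[OF y(2)] center_in]
  let ?f = "\<lambda>t. G (\<lambda>i. (1 - t) * y i + t * center S i) i"
  have "0 < ?f 0 * ?f 1"
  proof (rule continuous_on_nonzero_same_sign)
    show "continuous_on {0..1} ?f"
      by (rule continuous_on_G_segment) (use seg(1) i in auto)
    show "?f t \<noteq> 0" if "t \<in> {0..1}" for t
      by (rule G_nonzero) (use seg y that i in auto)
  qed
  then have "0 < G y i * G (center S) i" by simp
  then show "0 < sg (\<tau> S) i * G y i"
    using i by (auto simp: sg_def \<tau>_def zero_less_mult_iff)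
qed

text \<open>The closure of the previous statement: \<open>y\<close> is the limit of points of the
  open cell along the segment to the center.\<close>

lemma G_cell:
  assumes y: "y \<in> sphere_one k" "y \<in> cell k S"
  shows "G y \<in> cell k (\<tau> S)"
  unfolding cell_def
proof (intro CollectI allI impI)
  fix i assume i: "i < k"
  note seg = segment_cell[OF y center_in]
  let ?f = "\<lambda>t. sg (\<tau> S) i * G (\<lambda>i. (1 - t) * y i + t * center S i) i"
  have "0 \<le> ?f 0"
  proof (rule continuous_on_nonneg_at_0[where f = ?f])
    show "continuous_on {0..1} ?f"
      by (intro continuous_on_mult_left continuous_on_G_segment) (use seg(1) i in auto)
    show "0 \<le> ?f t" if "0 < t" "t \<le> 1" for t
      using G_open_cell[OF seg(1) seg(2), of t] that i by (auto simp: open_cell_def less_imp_le)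
  qed
  then show "0 \<le> sg (\<tau> S) i * G y i" by simp
qed

lemma F_cell_ex:
  assumes x: "x \<in> sphere_inf k" "x \<in> open_cell k T" and T: "T \<subseteq> {..<k}"
  shows "\<exists>S\<subseteq>{..<k}. F x \<in> cell k S \<and> \<tau> S = T"
proof -
  obtain S where S: "S \<subseteq> {..<k}" "F x \<in> cell k S" using ex_cell by blast
  have "x \<in> cell k (\<tau> S)" using G_cell[OF F_in[OF x(1)] S(2)] by (simp add: G_F x(1))
  then have "T = \<tau> S" using open_cell_cell_eq[OF x(2)] T by (auto simp: \<tau>_def)
  with S show ?thesis by blast
qed

text \<open>Every open cell contains a vector with entries 1 and -1, whose image lies in some closed
  cell; this gives surjectivity, and finiteness gives injectivity.\<close>

lemma bij_\<tau>: "bij_betw \<tau> (Pow {..<k}) (Pow {..<k})"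
proof -
  have sub: "\<tau> ` Pow {..<k} \<subseteq> Pow {..<k}" by (auto simp: \<tau>_def)
  have "T \<in> \<tau> ` Pow {..<k}" if "T \<subseteq> {..<k}" for T
  proof -
    have "(\<lambda>i. if i < k then sg T i else 0) \<in> sphere_inf k"
      using k_pos by (auto simp: sphere_inf_def vecs_def norm_inf_eq_1_iff sg_def)
    moreover have "(\<lambda>i. if i < k then sg T i else 0) \<in> open_cell k T"
      by (auto simp: open_cell_def sg_def)
    ultimately show ?thesis using F_cell_ex that by blast
  qed
  with sub have eq: "\<tau> ` Pow {..<k} = Pow {..<k}" by blast
  then have "inj_on \<tau> (Pow {..<k})" by (intro eq_card_imp_inj_on) auto
  with eq show ?thesis by (simp add: bij_betw_def)
qed

lemma \<tau>_inj: "S \<subseteq> {..<k} \<Longrightarrow> T \<subseteq> {..<k} \<Longrightarrow> \<tau> S = \<tau> T \<Longrightarrow> S = T"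
  using bij_\<tau> by (auto simp: bij_betw_def inj_on_def)

lemma F_cell:
  assumes x: "x \<in> sphere_inf k" "x \<in> cell k (\<tau> S)" and S: "S \<subseteq> {..<k}"
  shows "F x \<in> cell k S"
  unfolding cell_def
proof (intro CollectI allI impI)
  fix i assume i: "i < k"
  let ?T = "\<tau> S"
  \<comment> \<open>The path pushes the zero coordinates of \<open>x\<close> into the open cell and
    keeps a coordinate of modulus 1, hence stays on the sphere. Clamping \<open>t\<close> makes it
    1-Lipschitz on all reals.\<close>
  let ?\<gamma> = "\<lambda>t j. if j < k \<and> x j = 0 then min 1 (max 0 t) * sg ?T j else x j"
  let ?f = "\<lambda>t. sg S i * F (?\<gamma> t) i"
  have in_sphere: "?\<gamma> t \<in> sphere_inf k" if t: "t \<in> {0..1}" for t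
  proof -
    from x(1) obtain j where "j < k" "\<bar>x j\<bar> = 1" and "\<forall>j<k. \<bar>x j\<bar> \<le> 1" "x \<in> vecs k"
      by (auto simp: sphere_inf_def norm_inf_eq_1_iff)
    then show ?thesis using t
      unfolding sphere_inf_def norm_inf_eq_1_iff
      by (auto simp: vecs_def abs_mult sg_def intro!: exI[of _ j])
  qed
  have "0 \<le> ?f 0"
  proof (rule continuous_on_nonneg_at_0[where f = ?f])
    have "continuous_on {0..1} (\<lambda>t. F (?\<gamma> t) i)"
    proof (rule continuous_on_metric_cont_path[OF cont_F in_sphere, where C = 1])
      show "\<bar>u i - v i\<bar> \<le> dist_one k u v" for u v
        unfolding dist_one_def by (rule abs_le_norm_one) fact
      show "dist_inf k (?\<gamma> s) (?\<gamma> t) \<le> 1 * \<bar>s - t\<bar>" for s t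
        by (auto simp: dist_inf_def norm_inf_le_iff sg_def)
    qed
    then show "continuous_on {0..1} ?f" by (rule continuous_on_mult_left)
    show "0 \<le> ?f t" if t: "0 < t" "t \<le> 1" for t
    proof -
      have *: "?\<gamma> t \<in> open_cell k ?T"
        using x(2) t by (auto simp: open_cell_def cell_def sg_def order.order_iff_strict split: if_splits)
      have "?T \<subseteq> {..<k}" by (auto simp: \<tau>_def)
      with F_cell_ex[OF in_sphere *] t obtain S' where "S' \<subseteq> {..<k}" "F (?\<gamma> t) \<in> cell k S'" "\<tau> S' = ?T"
        by auto
      with \<tau>_inj S have "F (?\<gamma> t) \<in> cell k S" by metis
      with i show ?thesis by (auto simp: cell_def)
    qed
  qed
  moreover have "?\<gamma> 0 = x" by auto
  ultimately show "0 \<le> sg S i * F x i" by simp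
qed

lemma cells_Int_zero:
  assumes "y \<in> cell k S" "y \<in> cell k T" "j \<in> (S - T) \<union> (T - S)" "j < k"
  shows "y j = 0"
  using assms by (force simp: cell_def sg_def)

definition flip :: "nat set \<Rightarrow> nat \<Rightarrow> nat set" where
  "flip S j = (if j \<in> S then S - {j} else insert j S)"

text \<open>\<open>\<pi> i\<close> is the coordinate whose sign separates the cell \<open>P\<close>
  over the nonnegative orthant from the cell over the orthant adjacent across \<open>i\<close>. A
  nonnegative \<open>x\<close> with \<open>x i = 0\<close> lies in both orthants, so
  \<open>F x\<close> lies in both cells and vanishes at \<open>\<pi> i\<close>.\<close>

lemma coordinate_permutation:
  assumes "2 \<le> k"
  obtains \<pi> where "inj_on \<pi> {..<k}" "\<pi> ` {..<k} \<subseteq> {..<k}"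
    "\<And>x i. x \<in> sphere_inf k \<Longrightarrow> (\<And>j. 0 \<le> x j) \<Longrightarrow> i < k \<Longrightarrow> x i = 0 \<Longrightarrow> F x (\<pi> i) = 0"
proof -
  obtain P where P: "P \<subseteq> {..<k}" "\<tau> P = {..<k}"
    using bij_\<tau> unfolding bij_betw_def by (metis Pow_iff Pow_top imageE)
  have "\<exists>j<k. \<tau> (flip P j) = {..<k} - {i}" if i: "i < k" for i
  proof -
    obtain R where R: "R \<subseteq> {..<k}" "\<tau> R = {..<k} - {i}"
      using bij_\<tau> unfolding bij_betw_def by (metis Diff_subset Pow_iff imageE)
    have "P \<noteq> R" using P R i by auto
    then obtain j where j: "j \<in> (P - R) \<union> (R - P)" by blast
    then have jk: "j < k" using P R by auto
    let ?x = "\<lambda>j. if j < k \<and> j \<noteq> i then 1 else 0 :: real"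
    \<comment> \<open>A second coordinate is needed to carry the value 1.\<close>
    have "\<exists>j<k. j \<noteq> i" using assms i by (intro exI[of _ "if i = 0 then 1 else 0"]) auto
    then have x: "?x \<in> sphere_inf k"
      by (auto simp: sphere_inf_def vecs_def norm_inf_eq_1_iff)
    \<comment> \<open>\<open>?x\<close> lies in exactly two maximal cells, so its image does, and these differ in one sign\<close>
    have "F ?x \<in> cell k P" using F_cell[OF x _ P(1)] P(2) by (auto simp: cell_def sg_def)
    moreover have "F ?x \<in> cell k R" using F_cell[OF x _ R(1)] R(2) by (auto simp: cell_def sg_def)
    ultimately have "F ?x j = 0" using cells_Int_zero j jk by blast
    with \<open>F ?x \<in> cell k P\<close> have "F ?x \<in> cell k (flip P j)"
      by (auto simp: cell_def sg_def flip_def)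
    from G_cell[OF F_in[OF x] this] have "?x \<in> cell k (\<tau> (flip P j))"
      unfolding G_F[OF x] .
    then have "l \<in> \<tau> (flip P j)" if "l < k" "l \<noteq> i" for l
      using that by (auto simp: cell_def sg_def split: if_splits)
    \<comment> \<open>All coordinates of \<open>?x\<close> except the one at \<open>i\<close> are
      positive, so only the sign at \<open>i\<close> is free; injectivity of \<open>\<tau>\<close>
      then excludes the full set.\<close>
    then have "\<tau> (flip P j) \<in> {{..<k}, {..<k} - {i}}" by (auto simp: \<tau>_def)
    moreover have "\<tau> (flip P j) \<noteq> {..<k}"
    proof
      assume "\<tau> (flip P j) = {..<k}"
      moreover have "flip P j \<subseteq> {..<k}" using P(1) jk by (auto simp: flip_def)
      ultimately have "flip P j = P" using \<tau>_inj P by metis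
      then show False by (auto simp: flip_def split: if_splits)
    qed
    ultimately show ?thesis using jk by blast
  qed
  then obtain \<pi> where \<pi>: "\<And>i. i < k \<Longrightarrow> \<pi> i < k \<and> \<tau> (flip P (\<pi> i)) = {..<k} - {i}" by metis
  show thesis
  proof
    show "inj_on \<pi> {..<k}"
    proof (rule inj_onI)
      fix i j assume "i \<in> {..<k}" "j \<in> {..<k}" "\<pi> i = \<pi> j"
      then have "{..<k} - {i} = {..<k} - {j}" "i < k" using \<pi> by (metis lessThan_iff)+
      then show "i = j" by blast
    qed
    show "\<pi> ` {..<k} \<subseteq> {..<k}" using \<pi> by auto
    fix x i assume x: "x \<in> sphere_inf k" "\<And>j. 0 \<le> x j" "i < k" "x i = 0"
    have "F x \<in> cell k P"
      using F_cell[OF x(1) _ P(1)] P(2) x by (auto simp: cell_def sg_def)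
    moreover have "F x \<in> cell k (flip P (\<pi> i))"
      by (rule F_cell) (use x \<pi> P in \<open>auto simp: cell_def sg_def flip_def\<close>)
    moreover have "\<pi> i \<in> (P - flip P (\<pi> i)) \<union> (flip P (\<pi> i) - P)" by (auto simp: flip_def)
    ultimately show "F x (\<pi> i) = 0" using cells_Int_zero \<pi> x(3) by metis
  qed
qed

end

section \<open>Dyadic sums and the heap pattern of values\<close>

text \<open>In a zero sum the positive and negative parts balance, so each is half of the absolute
  sum.\<close>

lemma sum_subset_le_half_sum_abs:
  fixes f :: "'a \<Rightarrow> real"
  assumes "finite A" "B \<subseteq> A" "sum f A = 0"
  shows "sum f B \<le> (\<Sum>i\<in>A. \<bar>f i\<bar>) / 2"
proof -
  have "sum f (A - B) + sum f B = 0" using sum.subset_diff[of B A f] assms by simp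
  moreover have "sum f B \<le> (\<Sum>i\<in>B. \<bar>f i\<bar>)" "- sum f (A - B) \<le> (\<Sum>i\<in>A - B. \<bar>f i\<bar>)"
    by (auto simp: sum_negf[symmetric] intro!: sum_mono)
  moreover have "(\<Sum>i\<in>A. \<bar>f i\<bar>) = (\<Sum>i\<in>A - B. \<bar>f i\<bar>) + (\<Sum>i\<in>B. \<bar>f i\<bar>)"
    using sum.subset_diff assms by blast
  ultimately show ?thesis by linarith
qed

lemma floor_log_eqI:
  assumes "2 ^ n \<le> c" "c < 2 ^ Suc n"
  shows "floor_log c = n"
proof -
  have "0 < c" using assms(1) by (rule less_le_trans[rotated]) simp
  then have "2 ^ n < (2::nat) ^ Suc (floor_log c)" "(2::nat) ^ floor_log c < 2 ^ Suc n"
    using floor_log_exp2_le[OF \<open>0 < c\<close>] floor_log_exp2_gt[of c] assms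
    unfolding power_Suc by linarith+
  then have "n < Suc (floor_log c)" "floor_log c < Suc n"
    by (auto dest: power_less_imp_less_exp[rotated] simp del: power_Suc)
  then show ?thesis by simp
qed

text \<open>Exactly \<open>2 ^ t\<close> numbers have \<open>floor_log\<close> equal to
  \<open>t\<close>, namely those from \<open>2 ^ t\<close> up to
  \<open>2 ^ Suc t - 1\<close>.\<close>

lemma sum_floor_log:
  fixes \<phi> :: "nat \<Rightarrow> real"
  shows "(\<Sum>c=1..<2^n. \<phi> (floor_log c)) = (\<Sum>t<n. 2 ^ t * \<phi> t)"
proof (induction n)
  case (Suc n)
  have "(\<Sum>c=1..<2^Suc n. \<phi> (floor_log c))
      = (\<Sum>c=1..<2^n. \<phi> (floor_log c)) + (\<Sum>c=2^n..<2^Suc n. \<phi> (floor_log c))"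
    by (rule sum.atLeastLessThan_concat[symmetric]) auto
  also have "(\<Sum>c=2^n..<2^Suc n. \<phi> (floor_log c)) = (\<Sum>c\<in>{2^n..<2^Suc n::nat}. \<phi> n)"
    by (rule sum.cong) (auto simp: floor_log_eqI)
  finally show ?case by (simp add: Suc.IH del: One_nat_def)
qed auto

lemma sum_atLeastLessThan_pairs:
  fixes f :: "nat \<Rightarrow> real"
  shows "(\<Sum>j=2..<2*m. f j) = (\<Sum>c=1..<m. f (2 * c) + f (2 * c + 1))"
proof (induction m)
  case (Suc m)
  then show ?case by (cases "m = 0") (auto simp: sum.atLeastLessThan_Suc)
qed auto

text \<open>
  Coordinates are the nodes of a binary heap: \<open>2 c\<close> and \<open>2 c + 1\<close> form a pair for \<open>1 \<le> c < 2 ^ d\<close>,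
  where the even member is one level higher; there are \<open>2 ^ t\<close> pairs with upper level \<open>d - t\<close>.
\<close>

definition level :: "nat \<Rightarrow> nat \<Rightarrow> nat" where
  "level d j = (if 2 \<le> j \<and> j < 2 ^ Suc d then d - floor_log (j div 2) - j mod 2 else 0)"

text \<open>The exchange of all pairs. The slots 0, 1 and those from \<open>2 ^ Suc d\<close> on lie
  in no pair; they have level 0.\<close>

definition sibling :: "nat \<Rightarrow> nat \<Rightarrow> nat" where
  "sibling d j = (if 2 \<le> j \<and> j < 2 ^ Suc d then if even j then j + 1 else j - 1 else j)"

lemma level_even: "1 \<le> c \<Longrightarrow> c < 2 ^ d \<Longrightarrow> level d (2 * c) = d - floor_log c"
  and level_odd: "1 \<le> c \<Longrightarrow> c < 2 ^ d \<Longrightarrow> level d (2 * c + 1) = d - floor_log c - 1"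
  by (auto simp: level_def)

lemma sibling_even: "1 \<le> c \<Longrightarrow> c < 2 ^ d \<Longrightarrow> sibling d (2 * c) = 2 * c + 1"
  and sibling_odd: "1 \<le> c \<Longrightarrow> c < 2 ^ d \<Longrightarrow> sibling d (2 * c + 1) = 2 * c"
  by (auto simp: sibling_def)

lemma heap_cases:
  obtains "j < 2 \<or> 2 ^ Suc d \<le> j" "level d j = 0" "sibling d j = j"
  | c where "1 \<le> c" "c < 2 ^ d" "j = 2 * c"
  | c where "1 \<le> c" "c < 2 ^ d" "j = 2 * c + 1"
proof (cases "2 \<le> j \<and> j < 2 ^ Suc d")
  case True
  then have "1 \<le> j div 2" "j div 2 < 2 ^ d" by auto
  moreover have "j = 2 * (j div 2) \<or> j = 2 * (j div 2) + 1" by presburger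
  ultimately show thesis using that(2,3)[of "j div 2"] by argo
next
  case False
  then show thesis using that(1) by (auto simp: level_def sibling_def)
qed

lemma sibling_sibling: "sibling d (sibling d j) = j"
  by (cases rule: heap_cases[of j d]) (simp_all add: sibling_even sibling_odd del: One_nat_def)

lemma sibling_permutes:
  assumes "2 ^ Suc d \<le> k"
  shows "sibling d permutes {..<k}"
proof (rule bij_imp_permutes)
  have "sibling d j < k" if "j < k" for j
    using assms that by (cases rule: heap_cases[of j d]) (simp_all add: sibling_even sibling_odd del: One_nat_def)
  then show "bij_betw (sibling d) {..<k} {..<k}"
    by (intro bij_betw_byWitness[where f' = "sibling d"]) (auto simp: sibling_sibling)
  show "sibling d x = x" if "x \<notin> {..<k}" for x using assms that by (auto simp: sibling_def)
qed

text \<open>Divided by \<open>d\<close>, this bounds the distance between the vectors before and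
  after the exchange.\<close>

lemma level_sibling: "\<bar>real (level d (sibling d j)) - real (level d j)\<bar> \<le> 1"
proof (cases rule: heap_cases[of j d])
  case (2 c)
  then show ?thesis
    unfolding 2(3) sibling_even[OF 2(1,2)] level_even[OF 2(1,2)] level_odd[OF 2(1,2)] by linarith
next
  case (3 c)
  then show ?thesis
    unfolding 3(3) sibling_odd[OF 3(1,2)] level_even[OF 3(1,2)] level_odd[OF 3(1,2)] by linarith
qed simp

lemma level_le: "level d j \<le> d"
  by (simp add: level_def)

lemma level_2: "1 \<le> d \<Longrightarrow> level d 2 = d"
  using level_even[of 1 d] by (simp add: one_less_power[of "2::nat"] del: One_nat_def)

section \<open>Averaging over permutations\<close>

text \<open>In the application \<open>q v i\<close> is the mass that the image of
  \<open>v / d\<close> puts on coordinate \<open>\<pi> i\<close>. No equivariance of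
  \<open>q\<close> is assumed; averaging over \<open>\<rho>\<close> supplies the symmetry.\<close>

lemma exists_permutation_moving_mass:
  fixes q :: "(nat \<Rightarrow> nat) \<Rightarrow> nat \<Rightarrow> real"
  assumes k: "2 ^ Suc d \<le> k"
    and nonneg: "\<And>v i. 0 \<le> q v i"
    and total: "\<And>\<rho>. \<rho> permutes {..<k} \<Longrightarrow> (\<Sum>i<k. q (level d \<circ> \<rho>) i) = 1"
    and zero: "\<And>\<rho> i. \<rho> permutes {..<k} \<Longrightarrow> i < k \<Longrightarrow> level d (\<rho> i) = 0 \<Longrightarrow> q (level d \<circ> \<rho>) i = 0"
  shows "\<exists>\<rho>. \<rho> permutes {..<k} \<and>
    2 / 3 \<le> (\<Sum>i<k. \<bar>q (level d \<circ> \<rho>) i - q (level d \<circ> (sibling d \<circ> \<rho>)) i\<bar>)"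
proof (rule ccontr)
  assume "\<not> ?thesis"
  then have small: "(\<Sum>i<k. \<bar>q (level d \<circ> \<rho>) i - q (level d \<circ> (sibling d \<circ> \<rho>)) i\<bar>) < 2 / 3"
    if "\<rho> permutes {..<k}" for \<rho>
    using that by (meson not_le)
  define P where "P = {\<rho>. \<rho> permutes {..<k}}"
  \<comment> \<open>\<open>B j / card P\<close> is the average mass of the coordinate moved into slot \<open>j\<close>\<close>
  define B where "B j = (\<Sum>\<rho>\<in>P. q (level d \<circ> \<rho>) (inv \<rho> j))" for j
  have fin: "finite P" and card_pos: "0 < card P"
    using finite_permutations[of "{..<k}"] card_permutations[of "{..<k}" k] by (simp_all add: P_def)

  \<comment> \<open>Reindexing the average by \<open>\<rho> \<mapsto> t \<circ> \<rho>\<close>; used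
    below with \<open>t\<close> a transposition and with \<open>t\<close> the exchange of
    pairs.\<close>
  have B_shift: "B (t j) = (\<Sum>\<rho>\<in>P. q (level d \<circ> (t \<circ> \<rho>)) (inv \<rho> j))" if "t permutes {..<k}" for t j
  proof -
    have "B (t j) = (\<Sum>\<rho>\<in>P. q (level d \<circ> (t \<circ> \<rho>)) (inv (t \<circ> \<rho>) (t j)))"
      unfolding B_def P_def by (rule setum_permutations_compose_left[OF that])
    also have "\<dots> = (\<Sum>\<rho>\<in>P. q (level d \<circ> (t \<circ> \<rho>)) (inv \<rho> j))"
    proof (rule sum.cong)
      fix \<rho> assume "\<rho> \<in> P"
      then have "bij \<rho>" "bij t" using that permutes_bij by (auto simp: P_def)
      then show "q (level d \<circ> (t \<circ> \<rho>)) (inv (t \<circ> \<rho>) (t j)) = q (level d \<circ> (t \<circ> \<rho>)) (inv \<rho> j)"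
        by (simp add: o_inv_distrib bij_is_inj)
    qed simp
    finally show ?thesis .
  qed
  have B_level: "B i = B j" if "level d i = level d j" "i < k" "j < k" for i j
  proof -
    \<comment> \<open>Swapping two slots of equal level leaves the vector unchanged.\<close>
    have "level d \<circ> (Transposition.transpose i j \<circ> \<rho>) = level d \<circ> \<rho>" for \<rho> :: "nat \<Rightarrow> nat"
      using that(1) by (auto simp: fun_eq_iff Transposition.transpose_def)
    with B_shift[of "Transposition.transpose i j" j] permutes_swap_id[of i "{..<k}" j] that
    show ?thesis by (simp add: B_def)
  qed
  have B_zero: "B j = 0" if "level d j = 0" "j < k" for j
    unfolding B_def
  proof (rule sum.neutral, rule ballI)
    fix \<rho> assume "\<rho> \<in> P"
    then have \<rho>: "\<rho> permutes {..<k}" by (simp add: P_def)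
    then have "inv \<rho> j < k" "\<rho> (inv \<rho> j) = j"
      using that(2) permutes_in_image[OF permutes_inv[OF \<rho>], of j] permutes_inverses(1)[OF \<rho>] by auto
    then show "q (level d \<circ> \<rho>) (inv \<rho> j) = 0" using zero[OF \<rho>] that(1) by simp
  qed
  have B_total: "(\<Sum>j<k. B j) = real (card P)"
  proof -
    have "(\<Sum>j<k. q (level d \<circ> \<rho>) (inv \<rho> j)) = 1" if "\<rho> \<in> P" for \<rho>
      using sum.permute[OF permutes_inv, of \<rho> "{..<k}" "q (level d \<circ> \<rho>)"] that total
      by (simp add: P_def o_def)
    then show ?thesis unfolding B_def by (subst sum.swap) simp
  qed
  have B_nonneg: "0 \<le> B j" for j
    unfolding B_def by (intro sum_nonneg nonneg)

  \<comment> \<open>For each \<open>\<rho>\<close> the upper members lose less than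
    \<open>1 / 3\<close>: half of the total change, which is below \<open>2 / 3\<close> by
    \<open>small\<close>.\<close>
  have diff_less: "(\<Sum>c=1..<2^d. B (2 * c) - B (2 * c + 1)) < card P * (1 / 3)"
  proof -
    let ?D = "\<lambda>\<rho> i. q (level d \<circ> \<rho>) i - q (level d \<circ> (sibling d \<circ> \<rho>)) i"
    have "(\<Sum>c=1..<2^d. B (2 * c) - B (2 * c + 1)) = (\<Sum>c=1..<2^d. \<Sum>\<rho>\<in>P. ?D \<rho> (inv \<rho> (2 * c)))"
    proof (rule sum.cong)
      fix c :: nat assume "c \<in> {1..<2^d}"
      then have "B (2 * c + 1) = B (sibling d (2 * c))" by (simp add: sibling_even del: One_nat_def)
      also have "\<dots> = (\<Sum>\<rho>\<in>P. q (level d \<circ> (sibling d \<circ> \<rho>)) (inv \<rho> (2 * c)))"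
        by (rule B_shift[OF sibling_permutes[OF k]])
      finally show "B (2 * c) - B (2 * c + 1) = (\<Sum>\<rho>\<in>P. ?D \<rho> (inv \<rho> (2 * c)))"
        by (simp only: B_def[of "2 * c"] sum_subtractf)
    qed simp
    also have "\<dots> = (\<Sum>\<rho>\<in>P. \<Sum>c=1..<2^d. ?D \<rho> (inv \<rho> (2 * c)))" by (rule sum.swap)
    also have "\<dots> < (\<Sum>\<rho>\<in>P. 1 / 3)"
    proof (rule sum_strict_mono[OF fin])
      fix \<rho> assume "\<rho> \<in> P"
      then have \<rho>: "\<rho> permutes {..<k}" by (simp add: P_def)
      note inv\<rho> = permutes_inv[OF \<rho>]
      have inj: "inj_on (\<lambda>c. inv \<rho> (2 * c)) {1..<2^d}"
        by (intro inj_onI) (auto dest: injD[OF permutes_inj[OF inv\<rho>]])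
      have "(\<Sum>c=1..<2^d. ?D \<rho> (inv \<rho> (2 * c))) = sum (?D \<rho>) ((\<lambda>c. inv \<rho> (2 * c)) ` {1..<2^d})"
        by (simp only: sum.reindex[OF inj] o_def)
      also have "\<dots> \<le> (\<Sum>i<k. \<bar>?D \<rho> i\<bar>) / 2"
      proof (rule sum_subset_le_half_sum_abs)
        show "(\<lambda>c. inv \<rho> (2 * c)) ` {1..<2^d} \<subseteq> {..<k}"
        proof (rule image_subsetI)
          fix c :: nat assume "c \<in> {1..<2^d}"
          then have "2 * c \<in> {..<k}" using k by simp
          then show "inv \<rho> (2 * c) \<in> {..<k}" unfolding permutes_in_image[OF inv\<rho>] .
        qed
        show "(\<Sum>i<k. ?D \<rho> i) = 0"
          using total[OF \<rho>] total[OF permutes_compose[OF \<rho> sibling_permutes[OF k]]]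
          by (simp add: sum_subtractf)
      qed simp
      also have "\<dots> < 1 / 3" using small[OF \<rho>] by simp
      finally show "(\<Sum>c=1..<2^d. ?D \<rho> (inv \<rho> (2 * c))) < 1 / 3" .
    qed (use card_pos in auto)
    finally show ?thesis by simp
  qed
  \<comment> \<open>For \<open>1 \<le> s \<le> d\<close> the slot \<open>2 * 2 ^ (d - s)\<close> is
    the first even one of level \<open>s\<close>. For \<open>s = 0\<close> this formula would leave
    the heap, so the value 0 given by \<open>B_zero\<close> is set directly.\<close>
  define a where "a s = (if s = 0 then 0 else B (2 * 2 ^ (d - s)))" for s
  have B_a: "B j = a (level d j)" if "j < k" for j
  proof (cases "level d j = 0")
    case False
    then have "1 \<le> level d j" by simp
    then have *: "(2::nat) ^ (d - level d j) < 2 ^ d"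
      using level_le[of d j] by (intro power_strict_increasing) auto
    then have "level d (2 * 2 ^ (d - level d j)) = d - floor_log (2 ^ (d - level d j))"
      by (intro level_even) auto
    moreover have "2 * 2 ^ (d - level d j) < k"
      using * k unfolding power_Suc by linarith
    ultimately have "B (2 * 2 ^ (d - level d j)) = B j"
      using level_le[of d j] that by (intro B_level) auto
    then show ?thesis using False by (simp add: a_def)
  qed (use B_zero that in \<open>simp add: a_def\<close>)
  define X where "X = (\<Sum>t<d. 2 ^ t * a (d - t))"
  define Y where "Y = (\<Sum>t<d. 2 ^ t * a (d - t - 1))"
  have X: "(\<Sum>c=1..<2^d. B (2 * c)) = X"
    unfolding X_def sum_floor_log[symmetric]
  proof (rule sum.cong)
    fix c :: nat assume c: "c \<in> {1..<2^d}"
    then have "2 * c < k" using k by auto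
    with c show "B (2 * c) = a (d - floor_log c)"
      by (simp add: B_a level_even del: One_nat_def)
  qed simp
  have Y: "(\<Sum>c=1..<2^d. B (2 * c + 1)) = Y"
    unfolding Y_def sum_floor_log[symmetric, of "\<lambda>t. a (d - t - 1)"]
  proof (rule sum.cong)
    fix c :: nat assume c: "c \<in> {1..<2^d}"
    then have "2 * c + 1 < k" using k by auto
    with c show "B (2 * c + 1) = a (d - floor_log c - 1)"
      by (simp add: B_a level_odd del: One_nat_def)
  qed simp
  \<comment> \<open>Lower members of one generation and upper members of the next share a level, and
    the latter are twice as many. So \<open>2 * Y\<close> is \<open>X\<close> without its top term;
    the new last term vanishes since \<open>a 0 = 0\<close>.\<close>
  have "2 * Y = (\<Sum>t<d. 2 ^ Suc t * a (d - Suc t))"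
    by (simp add: Y_def sum_distrib_left mult.assoc)
  also have "\<dots> = X - a d"
    using sum.lessThan_Suc_shift[of "\<lambda>t. 2 ^ t * a (d - t)" d] by (simp add: X_def a_def)
  also have "\<dots> \<le> X" by (simp add: a_def B_nonneg)
  finally have "2 * Y \<le> X" .
  moreover from diff_less have "X - Y < card P * (1 / 3)" by (simp only: sum_subtractf X Y)
  moreover have "X + Y = real (card P)"
  proof -
    have "(\<Sum>j<k. B j) = (\<Sum>j=2..<2 * 2^d. B j)"
    proof (rule sum.mono_neutral_right)
      show "\<forall>j\<in>{..<k} - {2..<2 * 2^d}. B j = 0"
        by (intro ballI B_zero) (auto simp: level_def)
      show "{2..<2 * 2^d} \<subseteq> {..<k}" using k by auto
    qed simp
    also have "\<dots> = X + Y" by (simp only: sum_atLeastLessThan_pairs sum.distrib X Y)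
    finally show ?thesis using B_total by simp
  qed
  \<comment> \<open>\<open>2 * Y \<le> X\<close> and \<open>X + Y = card P\<close> force
    \<open>X - Y \<ge> card P / 3\<close>.\<close>
  ultimately show False by simp
qed

section \<open>The lower bound for the modulus and its consequences\<close>

text \<open>The real \<open>Sup\<close> is an upper bound only for bounded sets; here the diameter
  of the target sphere is at most 2.\<close>

lemma dist_one_le_modulus:
  assumes "x \<in> sphere_inf k" "y \<in> sphere_inf k" "dist_inf k x y \<le> t"
    and F: "\<And>x. x \<in> sphere_inf k \<Longrightarrow> F x \<in> sphere_one k"
  shows "dist_one k (F x) (F y) \<le> modulus k F t"
  unfolding modulus_def
proof (rule cSup_upper)
  have "dist_one k u v \<le> 2" if "u \<in> sphere_one k" "v \<in> sphere_one k" for u v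
  proof -
    have "dist_one k u v \<le> norm_one k u + norm_one k v"
      unfolding dist_one_def norm_one_def sum.distrib[symmetric] by (intro sum_mono) auto
    with that show ?thesis by (simp add: sphere_one_def)
  qed
  then show "bdd_above {dist_one k (F x) (F y) |x y.
      x \<in> sphere_inf k \<and> y \<in> sphere_inf k \<and> dist_inf k x y \<le> t}"
    using F by (auto simp: bdd_above_def)
qed (use assms in blast)

context supp_homeo
begin

text \<open>The quantitative core, with a smaller threshold for \<open>k\<close> and a larger
  constant than the theorem asks for.\<close>

lemma modulus_ge:
  assumes d: "1 \<le> d" and k: "2 ^ Suc d \<le> k"
  shows "2 / 3 \<le> modulus k F (1 / real d)"
proof -
  have "(2::nat) ^ 2 \<le> 2 ^ Suc d" using d by (intro power_increasing) auto
  with k have k4: "4 \<le> k" by (simp del: power_Suc)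
  then have "2 \<le> k" by simp
  then obtain \<pi> where inj: "inj_on \<pi> {..<k}" and sub: "\<pi> ` {..<k} \<subseteq> {..<k}"
    and \<pi>: "\<And>x i. x \<in> sphere_inf k \<Longrightarrow> (\<And>j. 0 \<le> x j) \<Longrightarrow> i < k \<Longrightarrow> x i = 0 \<Longrightarrow> F x (\<pi> i) = 0"
    using coordinate_permutation by metis
  have bij: "bij_betw \<pi> {..<k} {..<k}"
    using inj sub by (simp add: bij_betw_def endo_inj_surj)
  define w :: "(nat \<Rightarrow> nat) \<Rightarrow> nat \<Rightarrow> real" where "w v i = real (v i) / real d" for v i
  have w_sphere: "w (level d \<circ> \<rho>) \<in> sphere_inf k" if \<rho>: "\<rho> permutes {..<k}" for \<rho>
  proof -
    have "w (level d \<circ> \<rho>) i = 0" if "k \<le> i" for i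
      using permutes_not_in[OF \<rho>, of i] that k by (simp add: w_def level_def)
    moreover have "\<bar>w (level d \<circ> \<rho>) i\<bar> \<le> 1" for i
      using d level_le[of d "\<rho> i"] by (simp add: w_def)
    \<comment> \<open>Node 2 has the top level \<open>d\<close>, so the coordinate sent to it has
      the value 1.\<close>
    moreover have "inv \<rho> 2 < k" "\<bar>w (level d \<circ> \<rho>) (inv \<rho> 2)\<bar> = 1"
    proof -
      show "inv \<rho> 2 < k" using permutes_in_image[OF permutes_inv[OF \<rho>], of 2] k4 by simp
      show "\<bar>w (level d \<circ> \<rho>) (inv \<rho> 2)\<bar> = 1"
        using d by (simp add: w_def permutes_inverses(1)[OF \<rho>] level_2)
    qed
    ultimately show ?thesis unfolding sphere_inf_def vecs_def norm_inf_eq_1_iff by blast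
  qed
  have total: "(\<Sum>i<k. \<bar>F x (\<pi> i)\<bar>) = 1" if "x \<in> sphere_inf k" for x
    using sum.reindex_bij_betw[OF bij, of "\<lambda>i. \<bar>F x i\<bar>"] F_in[OF that]
    by (simp add: sphere_one_def norm_one_def)
  have "\<exists>\<rho>. \<rho> permutes {..<k} \<and> 2 / 3 \<le> (\<Sum>i<k.
      \<bar>\<bar>F (w (level d \<circ> \<rho>)) (\<pi> i)\<bar> - \<bar>F (w (level d \<circ> (sibling d \<circ> \<rho>))) (\<pi> i)\<bar>\<bar>)"
  proof (rule exists_permutation_moving_mass[OF k])
    fix \<rho> i assume "\<rho> permutes {..<k}" "i < k" "level d (\<rho> i) = 0"
    then show "\<bar>F (w (level d \<circ> \<rho>)) (\<pi> i)\<bar> = 0"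
      using \<pi>[OF w_sphere, of \<rho> i] by (simp add: w_def)
  next
    fix \<rho> assume "\<rho> permutes {..<k}"
    then show "(\<Sum>i<k. \<bar>F (w (level d \<circ> \<rho>)) (\<pi> i)\<bar>) = 1" by (rule total[OF w_sphere])
  qed simp
  then obtain \<rho> where \<rho>: "\<rho> permutes {..<k}" and ge: "2 / 3 \<le> (\<Sum>i<k.
      \<bar>\<bar>F (w (level d \<circ> \<rho>)) (\<pi> i)\<bar> - \<bar>F (w (level d \<circ> (sibling d \<circ> \<rho>))) (\<pi> i)\<bar>\<bar>)"
    by blast
  let ?x = "w (level d \<circ> \<rho>)" and ?y = "w (level d \<circ> (sibling d \<circ> \<rho>))"
  note ge
  also have "(\<Sum>i<k. \<bar>\<bar>F ?x (\<pi> i)\<bar> - \<bar>F ?y (\<pi> i)\<bar>\<bar>) \<le> (\<Sum>i<k. \<bar>F ?x (\<pi> i) - F ?y (\<pi> i)\<bar>)"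
    by (intro sum_mono abs_triangle_ineq3)
  also have "\<dots> = dist_one k (F ?x) (F ?y)"
    using sum.reindex_bij_betw[OF bij, of "\<lambda>i. \<bar>F ?x i - F ?y i\<bar>"]
    by (simp add: dist_one_def norm_one_def)
  also have "\<dots> \<le> modulus k F (1 / real d)"
  proof (rule dist_one_le_modulus)
    show "?x \<in> sphere_inf k" "?y \<in> sphere_inf k"
      using w_sphere \<rho> permutes_compose[OF \<rho> sibling_permutes[OF k]] by auto
    have "\<bar>?x i - ?y i\<bar> \<le> 1 / real d" for i
      using level_sibling[of d "\<rho> i"] d
      by (simp add: w_def diff_divide_distrib[symmetric] abs_minus_commute divide_right_mono)
    then show "dist_inf k ?x ?y \<le> 1 / real d" by (simp add: dist_inf_def norm_inf_le_iff)
  qed (rule F_in)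
  finally show ?thesis .
qed

end

lemma modulus_mono:
  assumes "homeo_spheres k F" "0 < k" "0 \<le> s" "s \<le> t"
  shows "modulus k F s \<le> modulus k F t"
proof -
  have F: "\<And>x. x \<in> sphere_inf k \<Longrightarrow> F x \<in> sphere_one k"
    using assms(1) by (auto simp: homeo_spheres_def bij_betw_def)
  \<comment> \<open>The pair \<open>(?e, ?e)\<close> shows that the set of distances is nonempty, as
    \<open>cSup_least\<close> requires.\<close>
  let ?e = "\<lambda>i::nat. if i = 0 then 1 else 0 :: real"
  have "?e \<in> sphere_inf k" "dist_inf k ?e ?e \<le> s"
    using assms by (auto simp: sphere_inf_def vecs_def norm_inf_eq_1_iff dist_inf_def norm_inf_le_iff)
  then have ne: "{dist_one k (F x) (F y) |x y.
      x \<in> sphere_inf k \<and> y \<in> sphere_inf k \<and> dist_inf k x y \<le> s} \<noteq> {}" by blast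
  show ?thesis
    unfolding modulus_def[of k F s]
  proof (rule cSup_least[OF ne])
    fix r assume "r \<in> {dist_one k (F x) (F y) |x y.
      x \<in> sphere_inf k \<and> y \<in> sphere_inf k \<and> dist_inf k x y \<le> s}"
    then obtain x y where "r = dist_one k (F x) (F y)" "x \<in> sphere_inf k" "y \<in> sphere_inf k"
      "dist_inf k x y \<le> s" by blast
    then show "r \<le> modulus k F t"
      using dist_one_le_modulus[of x k y t F] F assms(4) by force
  qed
qed

theorem theorem1p3:
  shows "(\<forall>d::nat. d \<ge> 1 \<longrightarrow>
            (\<forall>k::nat. k \<ge> 19 ^ (2 * d - 1) + 1 \<longrightarrow>
               (\<forall>F. homeo_spheres k F \<and> no_supp_increase k F \<longrightarrow>
                  modulus k F (1 / real d) \<ge> 1 / 2)))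
         \<and> \<not> (\<exists>Fs :: nat \<Rightarrow> (nat \<Rightarrow> real) \<Rightarrow> (nat \<Rightarrow> real).
                (\<forall>k\<ge>1. homeo_spheres k (Fs k) \<and> no_supp_increase k (Fs k)) \<and>
                (\<forall>e>0. \<exists>\<delta>>0. \<forall>k\<ge>1. modulus k (Fs k) \<delta> < e))"
proof (intro conjI allI impI notI)
  fix d k :: nat and F
  assume d: "1 \<le> d" and k: "19 ^ (2 * d - 1) + 1 \<le> k"
    and F: "homeo_spheres k F \<and> no_supp_increase k F"
  have "(2::nat) ^ Suc d \<le> 4 ^ d"
    using d power_increasing[of "Suc d" "2 * d" "2::nat"] by (simp add: power_mult)
  also have "\<dots> \<le> 19 ^ d" by (rule power_mono) auto
  also have "\<dots> \<le> 19 ^ (2 * d - 1)" using d by (intro power_increasing) auto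
  finally have "2 ^ Suc d \<le> k" using k by linarith
  moreover have "supp_homeo k F" by unfold_locales (use F k in auto)
  ultimately show "1 / 2 \<le> modulus k F (1 / real d)"
    using supp_homeo.modulus_ge[of k F d] d by linarith
next
  assume "\<exists>Fs :: nat \<Rightarrow> (nat \<Rightarrow> real) \<Rightarrow> (nat \<Rightarrow> real).
    (\<forall>k\<ge>1. homeo_spheres k (Fs k) \<and> no_supp_increase k (Fs k)) \<and>
    (\<forall>e>0. \<exists>\<delta>>0. \<forall>k\<ge>1. modulus k (Fs k) \<delta> < e)"
  then obtain Fs where Fs: "\<And>k. 1 \<le> k \<Longrightarrow> homeo_spheres k (Fs k) \<and> no_supp_increase k (Fs k)"
    and "\<forall>e>0. \<exists>\<delta>>0. \<forall>k\<ge>1. modulus k (Fs k) \<delta> < e"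
    by blast
  then obtain \<delta> where \<delta>: "0 < \<delta>" "\<And>k. 1 \<le> k \<Longrightarrow> modulus k (Fs k) \<delta> < 1 / 2"
    using half_gt_zero[OF zero_less_one] by blast
  obtain d :: nat where d: "1 \<le> d" "1 / real d \<le> \<delta>"
  proof -
    obtain n where "inverse (real (Suc n)) < \<delta>" using reals_Archimedean[OF \<delta>(1)] by blast
    then show thesis using that[of "Suc n"] by (simp add: inverse_eq_divide)
  qed
  \<comment> \<open>A single dimension refutes equi-uniform continuity: the least \<open>k\<close>
    that \<open>modulus_ge\<close> admits for a \<open>d\<close> with
    \<open>1 / d \<le> \<delta>\<close>.\<close>
  define k :: nat where "k = 2 ^ Suc d"
  have k: "1 \<le> k" "0 < k" by (simp_all add: k_def)
  have "supp_homeo k (Fs k)" by unfold_locales (use Fs[OF k(1)] k in auto)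
  then have "2 / 3 \<le> modulus k (Fs k) (1 / real d)"
    using supp_homeo.modulus_ge d(1) k_def by blast
  also have "\<dots> \<le> modulus k (Fs k) \<delta>"
    by (rule modulus_mono) (use Fs k d in auto)
  finally show False using \<delta>(2)[OF k(1)] by simp
qed

end
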